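(* Let $\mathcal{G}$ be a finite groupoid, $K$ a commutative ring, $R$ an associative unital $K$-algebra, and $\beta=(\{E_g\}_{g\in\mathcal{G}},\{\beta_g\}_{g\in\mathcal{G}})$ a unital action of $\mathcal{G}$ on $R$ with $R=\bigoplus_{e\in\mathcal{G}_0}E_e$. Suppose that $R$ is a $\beta$-Galois extension of $R^{\beta}$ and that $R^{\beta}$ is separable over $C(R)^{\beta}$. If $\overline{\mathcal{H}}=\{\mathcal{H}\}$ (that is, $\overline{\mathcal{H}}$ is a singleton) for each wide subgroupoid $\mathcal{H}$ of $\mathcal{G}$, then the Galois map $\theta:\mathcal{H}\mapsto R^{\beta_{\mathcal{H}}}$, defined on the set of wide subgroupoids of $\mathcal{G}$, is injective.
   Context: A groupoid $\mathcal{G}$ is a small category in which every morphism is invertible; it is identified with its set of morphisms, and is finite if this set is finite. $d(g)$, $r(g)$ are the domain and range of $g$, $\mathcal{G}_0$ is the set of objects, identified with the identity morphisms; $gh$ is defined iff $d(g)=r(h)$. A subgroupoid is a non-empty subset closed under (defined) products and inverses; a subgroupoid $\mathcal{H}$ is wide if $\mathcal{H}_0=\mathcal{G}_0$. An action $\beta=(\{E_g\},\{\beta_g\})$ of $\mathcal{G}$ on $R$: for each $g$, $E_g=E_{r(g)}$ is an ideal of $R$ and $\beta_g:E_{g^{-1}}\to E_g$ is a $K$-algebra isomorphism, with $\beta_e=\mathrm{Id}_{E_e}$ for $e\in\mathcal{G}_0$ and $\beta_g(\beta_h(r))=\beta_{gh}(r)$ whenever $d(g)=r(h)$ and $r\in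 E_{h^{-1}}=E_{(gh)^{-1}}$. It is unital if each $E_g$ has an identity element, denoted $1_g$. Invariants: $R^{\beta}=\{r\in R\mid \beta_g(r1_{g^{-1}})=r1_g \text{ for all } g\in\mathcal{G}\}$. $C(R)$ is the center of $R$ and $C(R)^{\beta}=C(R)\cap R^{\beta}$. For a wide subgroupoid $\mathcal{H}$, $\beta_{\mathcal{H}}=\{\beta_h\mid h\in\mathcal{H}\}$ is an action of $\mathcal{H}$ on $R$ and $R^{\beta_{\mathcal{H}}}=\{r\in R\mid \beta_h(r1_{h^{-1}})=r1_h \text{ for all } h\in\mathcal{H}\}$. $R$ is a $\beta$-Galois extension of $R^{\beta}$ if there are $x_i,y_i\in R$, $1\le i\le m$, with $\sum_i x_i\beta_g(y_i1_{g^{-1}})=\sum_{e\in\mathcal{G}_0}\delta_{e,g}1_e$ for all $g\in\mathcal{G}$. A ring $A$ is separable over a subring $S$ if there is $z=\sum_i a_i\otimes b_i\in A\otimes_S A$ with $\sum_i a_ib_i=1_A$ and $az=za$ for all $a\in A$. For $g\in\mathcal{G}$, $J_g=\{r\in E_g\mid r\beta_g(x1_{g^{-1}})=xr \text{ for all } x\in R\}$. For a subgroupoid $\mathcal{H}$, $S_{\mathcal{H}}=\{g\in\mathcal{H}\mid J_g\neq\{0\}\}$ and $\overline{\mathcal{H}}=\{\mathcal{L}\mid \mathcal{L} \text{ is a subgroupoid of } \mathcal{G} \text{ and } S_{\mathcal{L}}=S_{\mathcal{H}}\}$. *)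

theory Defs
  imports "HOL-Algebra.Algebra"
begin

section \<open>Groupoids\<close>

text \<open>A small category is identified with its set of morphisms \<open>mor\<close>, and its objects with the
  identity morphisms; so \<open>d\<close> and \<open>r\<close> take values in \<open>mor\<close>. The product \<open>cmp g h\<close> is only meaningful
  when \<open>d g = r h\<close>; its values elsewhere are irrelevant.\<close>

record 'g category_data =
  mor :: "'g set"
  dmn :: "'g \<Rightarrow> 'g"
  rng :: "'g \<Rightarrow> 'g"
  cmp :: "'g \<Rightarrow> 'g \<Rightarrow> 'g"

locale small_category =
  fixes G :: "'g category_data"
  assumes dmn_closed: "g \<in> mor G \<Longrightarrow> dmn G g \<in> mor G"
    and rng_closed: "g \<in> mor G \<Longrightarrow> rng G g \<in> mor G"
    and dmn_dmn: "g \<in> mor G \<Longrightarrow> dmn G (dmn G g) = dmn G g"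
    and rng_dmn: "g \<in> mor G \<Longrightarrow> rng G (dmn G g) = dmn G g"
    and dmn_rng: "g \<in> mor G \<Longrightarrow> dmn G (rng G g) = rng G g"
    and rng_rng: "g \<in> mor G \<Longrightarrow> rng G (rng G g) = rng G g"
    and cmp_closed: "\<lbrakk>g \<in> mor G; h \<in> mor G; dmn G g = rng G h\<rbrakk> \<Longrightarrow> cmp G g h \<in> mor G"
    and dmn_cmp: "\<lbrakk>g \<in> mor G; h \<in> mor G; dmn G g = rng G h\<rbrakk> \<Longrightarrow> dmn G (cmp G g h) = dmn G h"
    and rng_cmp: "\<lbrakk>g \<in> mor G; h \<in> mor G; dmn G g = rng G h\<rbrakk> \<Longrightarrow> rng G (cmp G g h) = rng G g"
    and cmp_dmn: "g \<in> mor G \<Longrightarrow> cmp G g (dmn G g) = g"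
    and rng_cmp_left: "g \<in> mor G \<Longrightarrow> cmp G (rng G g) g = g"
    and cmp_assoc: "\<lbrakk>g \<in> mor G; h \<in> mor G; k \<in> mor G; dmn G g = rng G h; dmn G h = rng G k\<rbrakk>
      \<Longrightarrow> cmp G (cmp G g h) k = cmp G g (cmp G h k)"

definition inverse_morphisms :: "'g category_data \<Rightarrow> 'g \<Rightarrow> 'g \<Rightarrow> bool" where
  "inverse_morphisms G g h \<longleftrightarrow> h \<in> mor G \<and> dmn G h = rng G g \<and> rng G h = dmn G g \<and>
     cmp G g h = rng G g \<and> cmp G h g = dmn G g"

locale groupoid = small_category +
  assumes invertible: "g \<in> mor G \<Longrightarrow> \<exists>h. inverse_morphisms G g h"

definition ginv :: "'g category_data \<Rightarrow> 'g \<Rightarrow> 'g" where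
  "ginv G g = (THE h. inverse_morphisms G g h)"

text \<open>The identity morphisms lying in a set \<open>H\<close> of morphisms; for \<open>H = mor G\<close> these are all objects.\<close>

definition objs :: "'g category_data \<Rightarrow> 'g set \<Rightarrow> 'g set" where
  "objs G H = {e \<in> H. dmn G e = e}"

definition subgroupoid :: "'g category_data \<Rightarrow> 'g set \<Rightarrow> bool" where
  "subgroupoid G H \<longleftrightarrow> H \<subseteq> mor G \<and> H \<noteq> {} \<and>
     (\<forall>g\<in>H. \<forall>h\<in>H. dmn G g = rng G h \<longrightarrow> cmp G g h \<in> H) \<and>
     (\<forall>g\<in>H. ginv G g \<in> H)"

definition wide_subgroupoid :: "'g category_data \<Rightarrow> 'g set \<Rightarrow> bool" where
  "wide_subgroupoid G H \<longleftrightarrow> subgroupoid G H \<and> objs G H = objs G (mor G)"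

section \<open>Algebras and separability\<close>

text \<open>Associative unital algebras; the library's \<open>algebra\<close> is restricted to commutative ones.\<close>

locale assoc_algebra = module K R + ring R for K (structure) and R (structure) +
  assumes smult_mult_left: "\<lbrakk>k \<in> carrier K; x \<in> carrier R; y \<in> carrier R\<rbrakk>
      \<Longrightarrow> k \<odot>\<^bsub>R\<^esub> (x \<otimes>\<^bsub>R\<^esub> y) = (k \<odot>\<^bsub>R\<^esub> x) \<otimes>\<^bsub>R\<^esub> y"
    and smult_mult_right: "\<lbrakk>k \<in> carrier K; x \<in> carrier R; y \<in> carrier R\<rbrakk>
      \<Longrightarrow> k \<odot>\<^bsub>R\<^esub> (x \<otimes>\<^bsub>R\<^esub> y) = x \<otimes>\<^bsub>R\<^esub> (k \<odot>\<^bsub>R\<^esub> y)"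

definition ring_center :: "('a, 'm) ring_scheme \<Rightarrow> 'a set" where
  "ring_center R = {c \<in> carrier R. \<forall>x\<in>carrier R. c \<otimes>\<^bsub>R\<^esub> x = x \<otimes>\<^bsub>R\<^esub> c}"

definition is_ideal_unit :: "('a, 'm) ring_scheme \<Rightarrow> 'a set \<Rightarrow> 'a \<Rightarrow> bool" where
  "is_ideal_unit R I u \<longleftrightarrow> u \<in> I \<and> (\<forall>x\<in>I. u \<otimes>\<^bsub>R\<^esub> x = x \<and> x \<otimes>\<^bsub>R\<^esub> u = x)"

definition ideal_unit :: "('a, 'm) ring_scheme \<Rightarrow> 'a set \<Rightarrow> 'a" where
  "ideal_unit R I = (THE u. is_ideal_unit R I u)"

definition algebra_iso_on ::
  "('k, 'n) ring_scheme \<Rightarrow> ('k, 'a, 'm) module_scheme \<Rightarrow> 'a set \<Rightarrow> 'a set \<Rightarrow> ('a \<Rightarrow> 'a) \<Rightarrow> bool" where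
  "algebra_iso_on K R I J f \<longleftrightarrow> bij_betw f I J \<and>
     (\<forall>x\<in>I. \<forall>y\<in>I. f (x \<oplus>\<^bsub>R\<^esub> y) = f x \<oplus>\<^bsub>R\<^esub> f y) \<and>
     (\<forall>x\<in>I. \<forall>y\<in>I. f (x \<otimes>\<^bsub>R\<^esub> y) = f x \<otimes>\<^bsub>R\<^esub> f y) \<and>
     (\<forall>k\<in>carrier K. \<forall>x\<in>I. f (k \<odot>\<^bsub>R\<^esub> x) = k \<odot>\<^bsub>R\<^esub> f x)"

text \<open>\<open>R\<close> is the internal direct sum of the finite family \<open>E e\<close>, \<open>e \<in> I\<close>. The extensional function
  space makes the family of summands unique as a function.\<close>

definition internal_direct_sum :: "('a, 'm) ring_scheme \<Rightarrow> 'i set \<Rightarrow> ('i \<Rightarrow> 'a set) \<Rightarrow> bool" where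
  "internal_direct_sum R I E \<longleftrightarrow> (\<forall>e\<in>I. E e \<subseteq> carrier R) \<and>
     (\<forall>r\<in>carrier R. \<exists>!a. a \<in> (\<Pi>\<^sub>E e\<in>I. E e) \<and> r = (\<Oplus>\<^bsub>R\<^esub>e\<in>I. a e))"

text \<open>The abelian group \<open>A \<otimes>\<^sub>S A\<close>: the free abelian group on \<open>A \<times> A\<close> modulo biadditivity and
  \<open>S\<close>-balancedness. Following \<open>free_Abelian_group\<close>, it is written multiplicatively.\<close>

definition tensor_relators ::
  "('a, 'm) ring_scheme \<Rightarrow> 'a set \<Rightarrow> (('a \<times> 'a) \<Rightarrow>\<^sub>0 int) set" where
  "tensor_relators A S =
     {frag_of (a \<oplus>\<^bsub>A\<^esub> a', b) - frag_of (a, b) - frag_of (a', b) | a a' b.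
        a \<in> carrier A \<and> a' \<in> carrier A \<and> b \<in> carrier A} \<union>
     {frag_of (a, b \<oplus>\<^bsub>A\<^esub> b') - frag_of (a, b) - frag_of (a, b') | a b b'.
        a \<in> carrier A \<and> b \<in> carrier A \<and> b' \<in> carrier A} \<union>
     {frag_of (a \<otimes>\<^bsub>A\<^esub> s, b) - frag_of (a, s \<otimes>\<^bsub>A\<^esub> b) | a s b.
        a \<in> carrier A \<and> s \<in> S \<and> b \<in> carrier A}"

definition tensor_subgroup ::
  "('a, 'm) ring_scheme \<Rightarrow> 'a set \<Rightarrow> (('a \<times> 'a) \<Rightarrow>\<^sub>0 int) set" where
  "tensor_subgroup A S =
     generate (free_Abelian_group (carrier A \<times> carrier A)) (tensor_relators A S)"

definition tensor_square ::
  "('a, 'm) ring_scheme \<Rightarrow> 'a set \<Rightarrow> (('a \<times> 'a) \<Rightarrow>\<^sub>0 int) set monoid" where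
  "tensor_square A S =
     free_Abelian_group (carrier A \<times> carrier A) Mod tensor_subgroup A S"

definition pure_tensor ::
  "('a, 'm) ring_scheme \<Rightarrow> 'a set \<Rightarrow> 'a \<Rightarrow> 'a \<Rightarrow> (('a \<times> 'a) \<Rightarrow>\<^sub>0 int) set" where
  "pure_tensor A S a b =
     tensor_subgroup A S #>\<^bsub>free_Abelian_group (carrier A \<times> carrier A)\<^esub> frag_of (a, b)"

lemma comm_group_tensor_square:
  assumes "ring A" "S \<subseteq> carrier A"
  shows "comm_group (tensor_square A S)"
proof -
  note cl = ring.ring_simprules(1,5) [OF assms(1)]
  let ?F = "free_Abelian_group (carrier A \<times> carrier A)"
  have rel: "tensor_relators A S \<subseteq> carrier ?F"
    using assms(2) unfolding tensor_relators_def free_Abelian_group_def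
    by (auto dest!: subsetD [OF keys_diff] simp: cl subset_iff)
  have "subgroup (tensor_subgroup A S) ?F"
    unfolding tensor_subgroup_def
    by (rule group.generate_is_subgroup [OF group_free_Abelian_group rel])
  then show ?thesis
    unfolding tensor_square_def
    by (rule comm_group.abelian_FactGroup [OF abelian_free_Abelian_group])
qed

text \<open>For \<open>z = \<Sum> a\<^sub>i \<otimes> b\<^sub>i\<close> in the bimodule \<open>A \<otimes>\<^sub>S A\<close>, one has \<open>x z = \<Sum> x a\<^sub>i \<otimes> b\<^sub>i\<close> and
  \<open>z x = \<Sum> a\<^sub>i \<otimes> b\<^sub>i x\<close>. The products over \<open>tensor_square A S\<close> are these sums, since that group is
  written multiplicatively.\<close>

definition separable_over :: "('a, 'm) ring_scheme \<Rightarrow> 'a set \<Rightarrow> bool" where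
  "separable_over A S \<longleftrightarrow> (\<exists>(n::nat) a b.
     (\<forall>i\<in>{1..n}. a i \<in> carrier A \<and> b i \<in> carrier A) \<and>
     (\<Oplus>\<^bsub>A\<^esub>i\<in>{1..n}. a i \<otimes>\<^bsub>A\<^esub> b i) = \<one>\<^bsub>A\<^esub> \<and>
     (\<forall>x\<in>carrier A.
        (\<Otimes>\<^bsub>tensor_square A S\<^esub>i\<in>{1..n}. pure_tensor A S (x \<otimes>\<^bsub>A\<^esub> a i) (b i)) =
        (\<Otimes>\<^bsub>tensor_square A S\<^esub>i\<in>{1..n}. pure_tensor A S (a i) (b i \<otimes>\<^bsub>A\<^esub> x))))"

section \<open>Groupoid actions\<close>

text \<open>\<open>E g\<close> and \<open>\<beta> g\<close> matter only for \<open>g \<in> mor G\<close>, and \<open>\<beta> g\<close> only on \<open>E (ginv G g)\<close>.\<close>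

definition groupoid_action ::
  "'g category_data \<Rightarrow> ('k, 'n) ring_scheme \<Rightarrow> ('k, 'a, 'm) module_scheme \<Rightarrow>
   ('g \<Rightarrow> 'a set) \<Rightarrow> ('g \<Rightarrow> 'a \<Rightarrow> 'a) \<Rightarrow> bool" where
  "groupoid_action G K R E \<beta> \<longleftrightarrow>
     (\<forall>g\<in>mor G. ideal (E g) R \<and> E g = E (rng G g) \<and>
        algebra_iso_on K R (E (ginv G g)) (E g) (\<beta> g)) \<and>
     (\<forall>e\<in>objs G (mor G). \<forall>x\<in>E e. \<beta> e x = x) \<and>
     (\<forall>g\<in>mor G. \<forall>h\<in>mor G. dmn G g = rng G h \<longrightarrow>
        (\<forall>x\<in>E (ginv G h). \<beta> g (\<beta> h x) = \<beta> (cmp G g h) x))"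

definition unital_groupoid_action ::
  "'g category_data \<Rightarrow> ('k, 'n) ring_scheme \<Rightarrow> ('k, 'a, 'm) module_scheme \<Rightarrow>
   ('g \<Rightarrow> 'a set) \<Rightarrow> ('g \<Rightarrow> 'a \<Rightarrow> 'a) \<Rightarrow> bool" where
  "unital_groupoid_action G K R E \<beta> \<longleftrightarrow> groupoid_action G K R E \<beta> \<and>
     (\<forall>g\<in>mor G. \<exists>u. is_ideal_unit R (E g) u)"

text \<open>The invariants of the restriction of the action to \<open>H\<close>; \<open>H = mor G\<close> gives those of \<open>\<beta>\<close>.\<close>

definition invariant_ring ::
  "'g category_data \<Rightarrow> ('a, 'm) ring_scheme \<Rightarrow> ('g \<Rightarrow> 'a set) \<Rightarrow> ('g \<Rightarrow> 'a \<Rightarrow> 'a) \<Rightarrow> 'g set \<Rightarrow> 'a set" where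
  "invariant_ring G R E \<beta> H = {x \<in> carrier R.
     \<forall>h\<in>H. \<beta> h (x \<otimes>\<^bsub>R\<^esub> ideal_unit R (E (ginv G h))) = x \<otimes>\<^bsub>R\<^esub> ideal_unit R (E h)}"

definition galois_extension ::
  "'g category_data \<Rightarrow> ('a, 'm) ring_scheme \<Rightarrow> ('g \<Rightarrow> 'a set) \<Rightarrow> ('g \<Rightarrow> 'a \<Rightarrow> 'a) \<Rightarrow> bool" where
  "galois_extension G R E \<beta> \<longleftrightarrow> (\<exists>(m::nat) x y.
     (\<forall>i\<in>{1..m}. x i \<in> carrier R \<and> y i \<in> carrier R) \<and>
     (\<forall>g\<in>mor G.
        (\<Oplus>\<^bsub>R\<^esub>i\<in>{1..m}. x i \<otimes>\<^bsub>R\<^esub> \<beta> g (y i \<otimes>\<^bsub>R\<^esub> ideal_unit R (E (ginv G g)))) =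
        (\<Oplus>\<^bsub>R\<^esub>e\<in>objs G (mor G). if e = g then ideal_unit R (E e) else \<zero>\<^bsub>R\<^esub>)))"

definition J_set ::
  "'g category_data \<Rightarrow> ('a, 'm) ring_scheme \<Rightarrow> ('g \<Rightarrow> 'a set) \<Rightarrow> ('g \<Rightarrow> 'a \<Rightarrow> 'a) \<Rightarrow> 'g \<Rightarrow> 'a set" where
  "J_set G R E \<beta> g = {r \<in> E g. \<forall>x\<in>carrier R.
     r \<otimes>\<^bsub>R\<^esub> \<beta> g (x \<otimes>\<^bsub>R\<^esub> ideal_unit R (E (ginv G g))) = x \<otimes>\<^bsub>R\<^esub> r}"

definition S_set ::
  "'g category_data \<Rightarrow> ('a, 'm) ring_scheme \<Rightarrow> ('g \<Rightarrow> 'a set) \<Rightarrow> ('g \<Rightarrow> 'a \<Rightarrow> 'a) \<Rightarrow> 'g set \<Rightarrow> 'g set" where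
  "S_set G R E \<beta> H = {g \<in> H. J_set G R E \<beta> g \<noteq> {\<zero>\<^bsub>R\<^esub>}}"

text \<open>The class \<open>\<H>\<close>-bar; its members need not be wide.\<close>

definition S_class ::
  "'g category_data \<Rightarrow> ('a, 'm) ring_scheme \<Rightarrow> ('g \<Rightarrow> 'a set) \<Rightarrow> ('g \<Rightarrow> 'a \<Rightarrow> 'a) \<Rightarrow> 'g set \<Rightarrow> 'g set set" where
  "S_class G R E \<beta> H = {L. subgroupoid G L \<and> S_set G R E \<beta> L = S_set G R E \<beta> H}"

definition galois_map ::
  "'g category_data \<Rightarrow> ('a, 'm) ring_scheme \<Rightarrow> ('g \<Rightarrow> 'a set) \<Rightarrow> ('g \<Rightarrow> 'a \<Rightarrow> 'a) \<Rightarrow> 'g set \<Rightarrow> 'a set" where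
  "galois_map G R E \<beta> = (\<lambda>H. invariant_ring G R E \<beta> H)"

end

theory Submission
  imports Defs
begin

text \<open>Write \<open>b\<^sub>g(x) = \<beta>\<^sub>g(x 1\<^bsub>g\<inverse>\<^esub>)\<close> and \<open>tr\<^sub>H = \<Sum>\<^bsub>g\<in>H\<^esub> b\<^sub>g\<close>, and let \<open>x\<^sub>i, y\<^sub>i\<close> be Galois
  coordinates. For wide \<open>H\<close> one has \<open>\<Sum>\<^sub>i x\<^sub>i tr\<^sub>H(y\<^sub>i) = 1\<close>, and \<open>tr\<^sub>H(y\<^sub>i)\<close> is \<open>H\<close>-invariant; hence an
  element \<open>c\<close> that commutes with the \<open>H\<close>-invariants equals \<open>\<Sum>\<^sub>i x\<^sub>i c tr\<^sub>H(y\<^sub>i)\<close>. If moreover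
  \<open>c \<in> J\<^sub>h\<close>, then \<open>x\<^sub>i c = c b\<^sub>h(x\<^sub>i)\<close>, and \<open>\<Sum>\<^sub>i b\<^sub>h(x\<^sub>i) b\<^sub>g(y\<^sub>i)\<close> vanishes for \<open>g \<noteq> h\<close>; so \<open>c \<noteq> 0\<close>
  forces \<open>h \<in> H\<close>. As \<open>J\<^sub>h\<close> commutes with the \<open>L\<close>-invariants for \<open>h \<in> L\<close>, equal invariant rings of
  \<open>H\<close> and \<open>L\<close> give \<open>S\<^sub>H = S\<^sub>L\<close>, that is, \<open>L\<close> lies in the class of \<open>H\<close>.\<close>

section \<open>Inverses and left translations in a groupoid\<close>

context groupoid
begin

text \<open>The monoid argument h = h(gk) = (hg)k = k. Together with \<open>invertible\<close> it
  gives meaning to the description in \<open>ginv\<close>.\<close>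

lemma inverse_morphisms_unique:
  assumes "g \<in> mor G" "inverse_morphisms G g h" "inverse_morphisms G g k"
  shows "h = k"
proof -
  have h: "h \<in> mor G" "dmn G h = rng G g" "rng G h = dmn G g" "cmp G h g = dmn G g"
    and k: "k \<in> mor G" "dmn G k = rng G g" "rng G k = dmn G g" "cmp G g k = rng G g"
    using assms by (auto simp: inverse_morphisms_def)
  have "h = cmp G h (cmp G g k)"
    using cmp_dmn[OF h(1)] h k by simp
  also have "\<dots> = cmp G (cmp G h g) k"
    using cmp_assoc[of h g k] assms(1) h k by simp
  also have "\<dots> = k"
    using rng_cmp_left[OF k(1)] h k by simp
  finally show ?thesis .
qed

lemma inverse_morphisms_ginv: "g \<in> mor G \<Longrightarrow> inverse_morphisms G g (ginv G g)"
  unfolding ginv_def by (rule theI') (metis invertible inverse_morphisms_unique)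

lemma ginv_closed: "g \<in> mor G \<Longrightarrow> ginv G g \<in> mor G"
  and dmn_ginv: "g \<in> mor G \<Longrightarrow> dmn G (ginv G g) = rng G g"
  and rng_ginv: "g \<in> mor G \<Longrightarrow> rng G (ginv G g) = dmn G g"
  and cmp_ginv_right: "g \<in> mor G \<Longrightarrow> cmp G g (ginv G g) = rng G g"
  and cmp_ginv_left: "g \<in> mor G \<Longrightarrow> cmp G (ginv G g) g = dmn G g"
  using inverse_morphisms_ginv by (auto simp: inverse_morphisms_def)

lemma cmp_ginv_cancel_left:
  assumes "g \<in> mor G" "h \<in> mor G" "dmn G g = rng G h"
  shows "cmp G (ginv G g) (cmp G g h) = h"
proof -
  have "cmp G (ginv G g) (cmp G g h) = cmp G (cmp G (ginv G g) g) h"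
    using cmp_assoc[of "ginv G g" g h] assms by (simp add: ginv_closed dmn_ginv)
  also have "\<dots> = h"
    using rng_cmp_left[OF assms(2)] assms by (simp add: cmp_ginv_left)
  finally show ?thesis .
qed

lemma cmp_ginv_cancel_right:
  assumes "g \<in> mor G" "k \<in> mor G" "rng G g = rng G k"
  shows "cmp G g (cmp G (ginv G g) k) = k"
proof -
  have "cmp G g (cmp G (ginv G g) k) = cmp G (cmp G g (ginv G g)) k"
    using cmp_assoc[of g "ginv G g" k] assms by (simp add: ginv_closed dmn_ginv rng_ginv)
  also have "\<dots> = k"
    using rng_cmp_left[OF assms(2)] assms by (simp add: cmp_ginv_right)
  finally show ?thesis .
qed

lemma objs_mor_iff: "e \<in> objs G (mor G) \<longleftrightarrow> e \<in> mor G \<and> dmn G e = e"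
  by (simp add: objs_def)

lemma rng_in_objs: "g \<in> mor G \<Longrightarrow> rng G g \<in> objs G (mor G)"
  by (simp add: objs_mor_iff rng_closed dmn_rng)

lemma rng_obj: "e \<in> objs G (mor G) \<Longrightarrow> rng G e = e"
  by (metis objs_mor_iff rng_dmn)

text \<open>Left translation by the inverse of h, which also lies in \<open>H\<close>, undoes left
  translation by h. The source consists of the members of \<open>H\<close> composable with h; this
  reindexes the trace.\<close>

lemma bij_betw_cmp_left:
  assumes "subgroupoid G H" "h \<in> H"
  shows "bij_betw (cmp G h) {g \<in> H. rng G g = dmn G h} {k \<in> H. rng G k = rng G h}"
proof (rule bij_betwI[where g = "cmp G (ginv G h)"])
  have H: "H \<subseteq> mor G" "\<And>g k. \<lbrakk>g \<in> H; k \<in> H; dmn G g = rng G k\<rbrakk> \<Longrightarrow> cmp G g k \<in> H"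
      "\<And>g. g \<in> H \<Longrightarrow> ginv G g \<in> H"
    using assms(1) by (auto simp: subgroupoid_def)
  have h: "h \<in> mor G" using H assms(2) by blast
  show "cmp G h \<in> {g \<in> H. rng G g = dmn G h} \<rightarrow> {k \<in> H. rng G k = rng G h}"
    using H(1) h assms(2) by (auto intro!: H(2) rng_cmp)
  show "cmp G (ginv G h) \<in> {k \<in> H. rng G k = rng G h} \<rightarrow> {g \<in> H. rng G g = dmn G h}"
    using H(1) h assms(2)
    by (auto intro!: H(2,3) simp: rng_cmp ginv_closed dmn_ginv rng_ginv subset_iff)
  show "cmp G (ginv G h) (cmp G h g) = g" if "g \<in> {g \<in> H. rng G g = dmn G h}" for g
    using that H(1) h by (auto intro!: cmp_ginv_cancel_left)
  show "cmp G h (cmp G (ginv G h) k) = k" if "k \<in> {k \<in> H. rng G k = rng G h}" for k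
    using that H(1) h by (auto intro!: cmp_ginv_cancel_right)
qed

end

section \<open>Additive maps, double sums, units of ideals, direct sums\<close>

lemma (in abelian_group) additive_zero:
  assumes "f \<in> carrier G \<rightarrow> carrier G"
    and "\<And>x y. \<lbrakk>x \<in> carrier G; y \<in> carrier G\<rbrakk> \<Longrightarrow> f (x \<oplus> y) = f x \<oplus> f y"
  shows "f \<zero> = \<zero>"
proof -
  have "f \<zero> \<in> carrier G" using assms(1) by auto
  moreover have "f \<zero> \<oplus> f \<zero> = f \<zero>"
    using assms(2)[of \<zero> \<zero>] by simp
  ultimately show ?thesis
    by (metis add.r_cancel_one)
qed

lemma (in abelian_group) additive_finsum:
  assumes "f \<in> carrier G \<rightarrow> carrier G"
    and "\<And>x y. \<lbrakk>x \<in> carrier G; y \<in> carrier G\<rbrakk> \<Longrightarrow> f (x \<oplus> y) = f x \<oplus> f y"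
    and "finite A" "a \<in> A \<rightarrow> carrier G"
  shows "f (\<Oplus>i\<in>A. a i) = (\<Oplus>i\<in>A. f (a i))"
  using assms(3,4)
proof (induction A)
  case empty
  then show ?case by (simp add: additive_zero[OF assms(1,2)])
next
  case (insert i A)
  have "(\<lambda>i. f (a i)) \<in> A \<rightarrow> carrier G" "f (a i) \<in> carrier G"
    using insert.prems assms(1) by auto
  then show ?case
    using insert by (simp add: assms(2) Pi_def)
qed

lemma (in abelian_monoid) finsum_swap:
  assumes "finite A" "finite B" "\<And>i j. \<lbrakk>i \<in> A; j \<in> B\<rbrakk> \<Longrightarrow> f i j \<in> carrier G"
  shows "(\<Oplus>i\<in>A. \<Oplus>j\<in>B. f i j) = (\<Oplus>j\<in>B. \<Oplus>i\<in>A. f i j)"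
  using assms(1,3)
proof (induction A)
  case empty
  then show ?case by simp
next
  case (insert i A)
  have "(\<Oplus>k\<in>insert i A. \<Oplus>j\<in>B. f k j) = (\<Oplus>j\<in>B. f i j) \<oplus> (\<Oplus>j\<in>B. \<Oplus>k\<in>A. f k j)"
    using insert by (subst finsum_insert) (auto intro!: finsum_closed)
  also have "\<dots> = (\<Oplus>j\<in>B. f i j \<oplus> (\<Oplus>k\<in>A. f k j))"
    using insert.prems by (intro finsum_addf[symmetric]) (auto intro!: finsum_closed)
  also have "\<dots> = (\<Oplus>j\<in>B. \<Oplus>k\<in>insert i A. f k j)"
    using insert by (intro finsum_cong' refl) (auto intro!: finsum_closed)
  finally show ?case .
qed

text \<open>Two units v, w of one ideal agree, as w = w v = v, so existence alone justifies the
  description in \<open>ideal_unit\<close>.\<close>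

lemma (in ring) is_ideal_unit_ideal_unit:
  assumes "is_ideal_unit R I v"
  shows "is_ideal_unit R I (ideal_unit R I)"
proof -
  have "w = v" if "is_ideal_unit R I w" for w
    using assms that unfolding is_ideal_unit_def by metis
  then show ?thesis
    unfolding ideal_unit_def using assms by (rule theI[rotated])
qed

text \<open>Both products lie in the ideal, where v is neutral on either side, so both equal v x
  v.\<close>

lemma (in ring) ideal_unit_central:
  assumes "ideal I R" "is_ideal_unit R I v" "x \<in> carrier R"
  shows "v \<otimes> x = x \<otimes> v"
proof -
  interpret I: ideal I R by fact
  have v: "v \<in> I" "v \<in> carrier R"
    using assms(2) I.a_subset by (auto simp: is_ideal_unit_def)
  have "v \<otimes> x = v \<otimes> x \<otimes> v" "x \<otimes> v = v \<otimes> (x \<otimes> v)"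
    using assms v I.I_l_closed I.I_r_closed by (auto simp: is_ideal_unit_def)
  then show ?thesis using assms(3) v by (simp add: m_assoc)
qed

text \<open>A common element has two decompositions, one concentrated at i and one at j. Uniqueness
  identifies them, and their entries at i are z and zero.\<close>

lemma (in ring) internal_direct_sum_Int:
  assumes "internal_direct_sum R I E" "finite I" "\<And>i. i \<in> I \<Longrightarrow> \<zero> \<in> E i"
    and "i \<in> I" "j \<in> I" "i \<noteq> j" "z \<in> E i" "z \<in> E j"
  shows "z = \<zero>"
proof -
  have sub: "\<And>i. i \<in> I \<Longrightarrow> E i \<subseteq> carrier R"
    and uniq: "\<And>r. r \<in> carrier R \<Longrightarrow> \<exists>!a. a \<in> (\<Pi>\<^sub>E e\<in>I. E e) \<and> r = (\<Oplus>e\<in>I. a e)"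
    using assms(1) by (auto simp: internal_direct_sum_def)
  have z: "z \<in> carrier R" using sub assms(4,7) by blast
  define a where "a k = (\<lambda>e\<in>I. if k = e then z else \<zero>)" for k
  have "a k \<in> (\<Pi>\<^sub>E e\<in>I. E e) \<and> z = (\<Oplus>e\<in>I. a k e)" if "k \<in> I" "z \<in> E k" for k
  proof
    show "a k \<in> (\<Pi>\<^sub>E e\<in>I. E e)"
      using that assms(3) by (auto simp: a_def)
    have "(\<Oplus>e\<in>I. a k e) = (\<Oplus>e\<in>I. if k = e then z else \<zero>)"
      using z by (intro finsum_cong') (auto simp: a_def)
    also have "\<dots> = z"
      using finsum_singleton[OF that(1) assms(2), of "\<lambda>_. z"] z by simp
    finally show "z = (\<Oplus>e\<in>I. a k e)" by simp
  qed
  then have "a i = a j"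
    using uniq[OF z] assms(4-8) by blast
  then have "a i i = a j i" by simp
  then show ?thesis using assms(4,6) by (simp add: a_def)
qed

section \<open>Totalised groupoid actions, traces and invariants\<close>

text \<open>Here \<open>u g\<close> stands for \<open>1\<^sub>g\<close> and \<open>b g x\<close> for \<open>\<beta>\<^sub>g(x 1\<^bsub>g\<inverse>\<^esub>)\<close>, which makes every \<open>b g\<close> a total map
  on the ring; the ideal \<open>E\<^sub>g\<close> is recovered as \<open>{x. x u\<^sub>g = x}\<close>.\<close>

locale total_groupoid_action = groupoid G + ring R
  for G :: "'g category_data" and R (structure) +
  fixes u :: "'g \<Rightarrow> 'a" and b :: "'g \<Rightarrow> 'a \<Rightarrow> 'a"
  assumes finite_mor: "finite (mor G)"
    and u_closed: "g \<in> mor G \<Longrightarrow> u g \<in> carrier R"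
    and u_central: "\<lbrakk>g \<in> mor G; x \<in> carrier R\<rbrakk> \<Longrightarrow> u g \<otimes> x = x \<otimes> u g"
    and u_rng: "g \<in> mor G \<Longrightarrow> u (rng G g) = u g"
    and u_orth: "\<lbrakk>e \<in> objs G (mor G); f \<in> objs G (mor G); e \<noteq> f\<rbrakk> \<Longrightarrow> u e \<otimes> u f = \<zero>"
    and u_sum: "(\<Oplus>e\<in>objs G (mor G). u e) = \<one>"
    and b_closed: "\<lbrakk>g \<in> mor G; x \<in> carrier R\<rbrakk> \<Longrightarrow> b g x \<in> carrier R"
    and b_add: "\<lbrakk>g \<in> mor G; x \<in> carrier R; y \<in> carrier R\<rbrakk> \<Longrightarrow> b g (x \<oplus> y) = b g x \<oplus> b g y"
    and b_mult: "\<lbrakk>g \<in> mor G; x \<in> carrier R; y \<in> carrier R\<rbrakk> \<Longrightarrow> b g (x \<otimes> y) = b g x \<otimes> b g y"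
    and b_u: "\<lbrakk>g \<in> mor G; x \<in> carrier R\<rbrakk> \<Longrightarrow> b g x \<otimes> u g = b g x"
    and b_cut: "\<lbrakk>g \<in> mor G; x \<in> carrier R\<rbrakk> \<Longrightarrow> b g (x \<otimes> u (dmn G g)) = b g x"
    and b_cmp: "\<lbrakk>g \<in> mor G; h \<in> mor G; dmn G g = rng G h; x \<in> carrier R\<rbrakk>
      \<Longrightarrow> b g (b h x) = b (cmp G g h) x"
begin

definition trace :: "'g set \<Rightarrow> 'a \<Rightarrow> 'a" where
  "trace H z = (\<Oplus>g\<in>H. b g z)"

definition invariants :: "'g set \<Rightarrow> 'a set" where
  "invariants H = {x \<in> carrier R. \<forall>h\<in>H. b h x = x \<otimes> u h}"

text \<open>This is J_g in total form; the equation \<open>c \<otimes> u g = c\<close> encodes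
  membership in E_g.\<close>

definition twisted_center :: "'g \<Rightarrow> 'a set" where
  "twisted_center g = {c \<in> carrier R. c \<otimes> u g = c \<and> (\<forall>x\<in>carrier R. c \<otimes> b g x = x \<otimes> c)}"

lemma b_Pi: "g \<in> mor G \<Longrightarrow> b g \<in> carrier R \<rightarrow> carrier R"
  by (auto intro: b_closed)

lemma b_zero: "g \<in> mor G \<Longrightarrow> b g \<zero> = \<zero>"
  using additive_zero[OF b_Pi b_add] .

lemma b_finsum:
  "\<lbrakk>g \<in> mor G; finite A; a \<in> A \<rightarrow> carrier R\<rbrakk> \<Longrightarrow> b g (\<Oplus>i\<in>A. a i) = (\<Oplus>i\<in>A. b g (a i))"
  using additive_finsum[OF b_Pi b_add] .

lemma u_mult_eq_zero:
  assumes "g \<in> mor G" "h \<in> mor G" "rng G g \<noteq> rng G h"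
  shows "u g \<otimes> u h = \<zero>"
  using u_orth[OF rng_in_objs rng_in_objs, of g h] assms by (simp add: u_rng)

text \<open>The inner value lies in the ideal at \<open>rng G h\<close>, while \<open>b g\<close>
  sees only the component at \<open>dmn G g\<close>. Totalising thus extends the composition law by
  zero.\<close>

lemma b_comp_eq_zero:
  assumes "g \<in> mor G" "h \<in> mor G" "dmn G g \<noteq> rng G h" "x \<in> carrier R"
  shows "b g (b h x) = \<zero>"
proof -
  have "b g (b h x) = b g (b h x \<otimes> (u h \<otimes> u (dmn G g)))"
    using assms by (simp add: b_cut b_u b_closed u_closed dmn_closed flip: m_assoc)
  also have "u h \<otimes> u (dmn G g) = \<zero>"
    using assms by (intro u_mult_eq_zero) (auto simp: dmn_closed rng_dmn)
  finally show ?thesis using assms by (simp add: b_closed b_zero)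
qed

lemma b_mult_u:
  assumes "g \<in> mor G" "h \<in> mor G" "x \<in> carrier R"
  shows "b g x \<otimes> u h = (if rng G g = rng G h then b g x else \<zero>)"
proof (cases "rng G g = rng G h")
  case True
  then have "u h = u g" using u_rng[of g] u_rng[of h] assms by simp
  then show ?thesis using assms True by (simp add: b_u)
next
  case False
  have "b g x \<otimes> u h = b g x \<otimes> (u g \<otimes> u h)"
    using assms by (simp add: b_u b_closed u_closed flip: m_assoc)
  then show ?thesis using assms False by (simp add: u_mult_eq_zero b_closed)
qed

lemma b_mult_b_eq_zero:
  assumes "g \<in> mor G" "h \<in> mor G" "rng G g \<noteq> rng G h" "x \<in> carrier R" "y \<in> carrier R"
  shows "b g x \<otimes> b h y = \<zero>"
proof -
  have "b g x \<otimes> b h y = b g x \<otimes> (u h \<otimes> b h y)"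
    using assms by (simp add: u_central b_u b_closed)
  also have "\<dots> = b g x \<otimes> u h \<otimes> b h y"
    using assms by (simp add: m_assoc b_closed u_closed)
  finally show ?thesis
    using assms by (simp add: b_mult_u b_closed)
qed

text \<open>On an invariant a the twist is only a factor \<open>u h\<close>, which c absorbs: a c =
  c b_h(a) = c u_h a = c a.\<close>

lemma twisted_center_commutes:
  assumes "h \<in> H" "H \<subseteq> mor G" "c \<in> twisted_center h" "a \<in> invariants H"
  shows "c \<otimes> a = a \<otimes> c"
proof -
  have h: "h \<in> mor G" using assms by blast
  have c: "c \<in> carrier R" "c \<otimes> u h = c" "\<And>x. x \<in> carrier R \<Longrightarrow> c \<otimes> b h x = x \<otimes> c"
    using assms(3) by (auto simp: twisted_center_def)
  have a: "a \<in> carrier R" "b h a = a \<otimes> u h"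
    using assms(1,4) by (auto simp: invariants_def)
  have "a \<otimes> c = c \<otimes> (u h \<otimes> a)"
    using c(3)[OF a(1)] a(2) u_central[OF h a(1)] by simp
  also have "\<dots> = c \<otimes> a"
    using c a h by (simp add: u_closed flip: m_assoc)
  finally show ?thesis by simp
qed

lemma trace_closed: "\<lbrakk>H \<subseteq> mor G; z \<in> carrier R\<rbrakk> \<Longrightarrow> trace H z \<in> carrier R"
  unfolding trace_def by (auto intro!: finsum_closed b_closed)

text \<open>Applying \<open>b h\<close> kills the summands not composable with h, and left
  translation carries the others onto the members of \<open>H\<close> with the range of h. These are
  exactly the summands that survive multiplication by \<open>u h\<close>.\<close>

lemma trace_in_invariants:
  assumes H: "subgroupoid G H" and z: "z \<in> carrier R"
  shows "trace H z \<in> invariants H"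
proof -
  have sub: "H \<subseteq> mor G" using H by (simp add: subgroupoid_def)
  then have fin: "finite H" using finite_mor by (rule finite_subset)
  have bc: "b g z \<in> carrier R" if "g \<in> H" for g
    using that sub z by (auto intro: b_closed)
  have "b h (trace H z) = trace H z \<otimes> u h" if h: "h \<in> H" for h
  proof -
    have hm: "h \<in> mor G" using h sub by blast
    let ?A = "{g \<in> H. rng G g = dmn G h}" and ?B = "{k \<in> H. rng G k = rng G h}"
    have bij: "bij_betw (cmp G h) ?A ?B" by (rule bij_betw_cmp_left[OF H h])
    have "b h (trace H z) = (\<Oplus>g\<in>H. b h (b g z))"
      unfolding trace_def using fin hm bc by (intro b_finsum) auto
    also have "\<dots> = (\<Oplus>g\<in>?A. b (cmp G h g) z)"
      using fin hm sub z
      by (intro add.finprod_mono_neutral_cong_right)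
        (auto simp: b_cmp subset_iff intro!: b_comp_eq_zero b_closed)
    also have "\<dots> = (\<Oplus>k\<in>cmp G h ` ?A. b k z)"
      using bij bc by (intro finsum_reindex[symmetric]) (auto simp: bij_betw_def)
    also have "\<dots> = (\<Oplus>k\<in>?B. b k z)"
      using bij by (simp add: bij_betw_def)
    also have "\<dots> = (\<Oplus>g\<in>H. b g z \<otimes> u h)"
      using fin hm sub z
      by (intro add.finprod_mono_neutral_cong_left)
        (auto simp: b_mult_u subset_iff b_closed)
    also have "\<dots> = trace H z \<otimes> u h"
      unfolding trace_def using fin hm bc by (intro finsum_ldistr[symmetric]) (auto intro: u_closed)
    finally show ?thesis .
  qed
  then show ?thesis
    using trace_closed[OF sub z] by (simp add: invariants_def)
qed

end

section \<open>Galois coordinates and the vanishing argument\<close>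

locale galois_groupoid_action = total_groupoid_action G R u b
  for G :: "'g category_data" and R (structure) and u :: "'g \<Rightarrow> 'a" and b :: "'g \<Rightarrow> 'a \<Rightarrow> 'a" +
  fixes I :: "'i set" and x y :: "'i \<Rightarrow> 'a"
  assumes finite_I: "finite I"
    and x_closed: "i \<in> I \<Longrightarrow> x i \<in> carrier R"
    and y_closed: "i \<in> I \<Longrightarrow> y i \<in> carrier R"
    and coordinates: "g \<in> mor G \<Longrightarrow>
      (\<Oplus>i\<in>I. x i \<otimes> b g (y i)) = (if g \<in> objs G (mor G) then u g else \<zero>)"
begin

text \<open>Apply \<open>b h\<close> to the coordinate identity at k = h^-1 g, whose right-hand side
  is zero unless k is an identity. If the ranges differ, each summand vanishes by
  orthogonality.\<close>

lemma coordinates_twisted: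
  assumes g: "g \<in> mor G" and h: "h \<in> mor G" and ne: "g \<noteq> h"
  shows "(\<Oplus>i\<in>I. b h (x i) \<otimes> b g (y i)) = \<zero>"
proof (cases "rng G h = rng G g")
  case False
  then show ?thesis
    using g h by (intro add.finprod_one_eqI) (simp add: b_mult_b_eq_zero x_closed y_closed)
next
  case True
  let ?k = "cmp G (ginv G h) g"
  have k: "?k \<in> mor G" "rng G ?k = dmn G h" "cmp G h ?k = g"
    using g h True
    by (auto intro!: cmp_closed cmp_ginv_cancel_right simp: ginv_closed dmn_ginv rng_ginv rng_cmp)
  \<comment> \<open>An identity k equals its range \<open>dmn G h\<close>, and then g = h k =
    h.\<close>
  have "?k \<notin> objs G (mor G)"
  proof
    assume "?k \<in> objs G (mor G)"
    then have "?k = dmn G h" using rng_obj k(2) by metis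
    then show False using k(3) cmp_dmn[OF h] ne by simp
  qed
  then have "\<zero> = b h (\<Oplus>i\<in>I. x i \<otimes> b ?k (y i))"
    using coordinates[OF k(1)] h by (simp add: b_zero)
  also have "\<dots> = (\<Oplus>i\<in>I. b h (x i \<otimes> b ?k (y i)))"
    using h k finite_I by (intro b_finsum) (auto intro: b_closed x_closed y_closed)
  also have "\<dots> = (\<Oplus>i\<in>I. b h (x i) \<otimes> b g (y i))"
    using g h k
    by (intro finsum_cong') (auto simp: b_mult b_cmp b_closed x_closed y_closed)
  finally show ?thesis by simp
qed

text \<open>Summing the coordinate identities over \<open>H\<close> leaves the units of the objects
  in \<open>H\<close>; by wideness these are all objects, and their units add up to one.\<close>

lemma coordinates_trace:
  assumes "wide_subgroupoid G H"
  shows "(\<Oplus>i\<in>I. x i \<otimes> trace H (y i)) = \<one>"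
proof -
  have sub: "H \<subseteq> mor G" and objs: "objs G (mor G) \<subseteq> H"
    using assms by (auto simp: wide_subgroupoid_def subgroupoid_def objs_def)
  then have fin: "finite H" using finite_mor finite_subset by blast
  have "(\<Oplus>i\<in>I. x i \<otimes> trace H (y i)) = (\<Oplus>i\<in>I. \<Oplus>g\<in>H. x i \<otimes> b g (y i))"
    unfolding trace_def using fin sub
    by (intro finsum_cong' refl finsum_rdistr)
      (auto intro!: finsum_closed b_closed x_closed y_closed)
  also have "\<dots> = (\<Oplus>g\<in>H. \<Oplus>i\<in>I. x i \<otimes> b g (y i))"
    using fin finite_I sub by (intro finsum_swap) (auto intro!: b_closed x_closed y_closed)
  also have "\<dots> = (\<Oplus>g\<in>H. if g \<in> objs G (mor G) then u g else \<zero>)"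
    using sub by (intro finsum_cong' refl coordinates) (auto simp: subset_iff u_closed)
  also have "\<dots> = (\<Oplus>e\<in>objs G (mor G). u e)"
    using fin objs sub
    by (intro add.finprod_mono_neutral_cong_right) (auto intro!: u_closed)
  finally show ?thesis by (simp add: u_sum)
qed

text \<open>Write c as 1 c through \<open>coordinates_trace\<close> and move c to the left of every
  summand: the traces let it pass, and passing x_i turns it into \<open>b h (x i)\<close>. The
  remaining sum vanishes by \<open>coordinates_twisted\<close>.\<close>

lemma twisted_center_meets_centralizer:
  assumes H: "wide_subgroupoid G H" and h: "h \<in> mor G" "h \<notin> H"
    and c: "c \<in> twisted_center h" and comm: "\<And>a. a \<in> invariants H \<Longrightarrow> c \<otimes> a = a \<otimes> c"
  shows "c = \<zero>"
proof -
  have subg: "subgroupoid G H" and sub: "H \<subseteq> mor G"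
    using H by (auto simp: wide_subgroupoid_def subgroupoid_def)
  then have fin: "finite H" using finite_mor finite_subset by blast
  have cR: "c \<in> carrier R" and cb: "\<And>z. z \<in> carrier R \<Longrightarrow> c \<otimes> b h z = z \<otimes> c"
    using c by (auto simp: twisted_center_def)
  have trR: "trace H (y i) \<in> carrier R" if "i \<in> I" for i
    using that sub by (intro trace_closed y_closed)
  have bx: "b h (x i) \<in> carrier R" if "i \<in> I" for i
    using that h by (intro b_closed x_closed)
  have sw: "x i \<otimes> trace H (y i) \<otimes> c = c \<otimes> (b h (x i) \<otimes> trace H (y i))" if i: "i \<in> I" for i
  proof -
    have "x i \<otimes> trace H (y i) \<otimes> c = x i \<otimes> (c \<otimes> trace H (y i))"
      using comm[OF trace_in_invariants[OF subg y_closed[OF i]]] i cR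
      by (simp add: m_assoc x_closed trR)
    also have "\<dots> = c \<otimes> b h (x i) \<otimes> trace H (y i)"
      using i cR by (simp add: cb x_closed trR flip: m_assoc)
    finally show ?thesis using i cR by (simp add: m_assoc bx trR)
  qed
  have "c = (\<Oplus>i\<in>I. x i \<otimes> trace H (y i)) \<otimes> c"
    using cR by (simp add: coordinates_trace[OF H])
  also have "\<dots> = (\<Oplus>i\<in>I. x i \<otimes> trace H (y i) \<otimes> c)"
    using finite_I cR by (intro finsum_ldistr) (auto simp: x_closed trR)
  also have "\<dots> = (\<Oplus>i\<in>I. c \<otimes> (b h (x i) \<otimes> trace H (y i)))"
    using cR by (intro finsum_cong') (auto simp: sw bx trR)
  also have "\<dots> = c \<otimes> (\<Oplus>i\<in>I. b h (x i) \<otimes> trace H (y i))"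
    using finite_I cR by (intro finsum_rdistr[symmetric]) (auto simp: bx trR)
  also have "(\<Oplus>i\<in>I. b h (x i) \<otimes> trace H (y i)) = (\<Oplus>i\<in>I. \<Oplus>g\<in>H. b h (x i) \<otimes> b g (y i))"
    unfolding trace_def using fin sub
    by (intro finsum_cong' refl finsum_rdistr)
      (auto intro!: finsum_closed b_closed y_closed bx)
  also have "\<dots> = (\<Oplus>g\<in>H. \<Oplus>i\<in>I. b h (x i) \<otimes> b g (y i))"
    using fin finite_I sub by (intro finsum_swap) (auto intro!: b_closed y_closed bx)
  \<comment> \<open>Every g in \<open>H\<close> differs from h, which lies outside \<open>H\<close>,
    so each inner sum is zero.\<close>
  also have "\<dots> = \<zero>"
    using h sub by (intro add.finprod_one_eqI coordinates_twisted) auto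
  finally show ?thesis using cR by simp
qed

text \<open>As h is in \<open>H\<close>, its twisted center centralises the invariants of
  \<open>H\<close>, hence those of \<open>L\<close>; were h outside \<open>L\<close>, the twisted
  center would be zero.\<close>

lemma twisted_center_nonzero_subset:
  assumes "wide_subgroupoid G H" "wide_subgroupoid G L" "invariants H = invariants L"
    and "h \<in> H" "twisted_center h \<noteq> {\<zero>}"
  shows "h \<in> L"
proof (rule ccontr)
  assume "h \<notin> L"
  have sub: "H \<subseteq> mor G" using assms(1) by (simp add: wide_subgroupoid_def subgroupoid_def)
  then have h: "h \<in> mor G" using assms(4) by blast
  \<comment> \<open>The empty set also differs from the zero ideal, so a member must be
    exhibited.\<close>
  have "\<zero> \<in> twisted_center h"
    using h by (simp add: twisted_center_def u_closed b_closed)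
  moreover have "c = \<zero>" if "c \<in> twisted_center h" for c
    using twisted_center_meets_centralizer[OF assms(2) h \<open>h \<notin> L\<close> that]
      twisted_center_commutes[OF assms(4) sub that] assms(3) by simp
  ultimately show False using assms(5) by blast
qed

end

section \<open>From a unital action to the totalised one\<close>

text \<open>The direct sum makes the units orthogonal with sum one. The laws of the total maps come
  from those of the action, since x 1_{g^-1} always lies in the domain of \<beta>_g.\<close>

lemma total_groupoid_action_of_unital:
  fixes G :: "'g category_data" and R :: "('k, 'a, 'm) module_scheme"
  assumes "groupoid G" "finite (mor G)" "ring R"
    and act: "unital_groupoid_action G K R E \<beta>"
    and dsum: "internal_direct_sum R (objs G (mor G)) E"
  shows "total_groupoid_action G R (\<lambda>g. ideal_unit R (E g))
    (\<lambda>g x. \<beta> g (x \<otimes>\<^bsub>R\<^esub> ideal_unit R (E (ginv G g))))"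
proof -
  interpret groupoid G by fact
  interpret ring R by fact
  let ?u = "\<lambda>g. ideal_unit R (E g)"
  have id: "\<And>g. g \<in> mor G \<Longrightarrow> ideal (E g) R"
    and Er: "\<And>g. g \<in> mor G \<Longrightarrow> E g = E (rng G g)"
    and iso: "\<And>g. g \<in> mor G \<Longrightarrow> algebra_iso_on K R (E (ginv G g)) (E g) (\<beta> g)"
    and b2: "\<And>g h x. \<lbrakk>g \<in> mor G; h \<in> mor G; dmn G g = rng G h; x \<in> E (ginv G h)\<rbrakk>
       \<Longrightarrow> \<beta> g (\<beta> h x) = \<beta> (cmp G g h) x"
    and ex: "\<And>g. g \<in> mor G \<Longrightarrow> \<exists>v. is_ideal_unit R (E g) v"
    using act unfolding unital_groupoid_action_def groupoid_action_def by blast+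
  \<comment> \<open>The inverse of g has range \<open>dmn G g\<close>, and the ideals depend on
    ranges only.\<close>
  have Ei: "E (ginv G g) = E (dmn G g)" if "g \<in> mor G" for g
    using Er[OF ginv_closed[OF that]] that by (simp add: rng_ginv)
  have un: "is_ideal_unit R (E g) (?u g)" if "g \<in> mor G" for g
    using ex[OF that] is_ideal_unit_ideal_unit by blast
  have uE: "?u g \<in> E g" and ul: "\<And>x. x \<in> E g \<Longrightarrow> ?u g \<otimes>\<^bsub>R\<^esub> x = x"
    and ur: "\<And>x. x \<in> E g \<Longrightarrow> x \<otimes>\<^bsub>R\<^esub> ?u g = x" if "g \<in> mor G" for g
    using un[OF that] by (auto simp: is_ideal_unit_def)
  have Ec: "x \<in> carrier R" if "g \<in> mor G" "x \<in> E g" for g x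
    using ideal.Icarr[OF id] that by blast
  have uc: "?u g \<in> carrier R" if "g \<in> mor G" for g
    using Ec uE that by blast
  have E0: "\<zero>\<^bsub>R\<^esub> \<in> E g" if "g \<in> mor G" for g
    using additive_subgroup.zero_closed[OF ideal.axioms(1)[OF id]] that by blast
  have EL: "x \<otimes>\<^bsub>R\<^esub> a \<in> E g" and ER: "a \<otimes>\<^bsub>R\<^esub> x \<in> E g"
    if "g \<in> mor G" "a \<in> E g" "x \<in> carrier R" for g x a
    using ideal.I_l_closed[OF id] ideal.I_r_closed[OF id] that by blast+
  have cen: "?u g \<otimes>\<^bsub>R\<^esub> x = x \<otimes>\<^bsub>R\<^esub> ?u g" if "g \<in> mor G" "x \<in> carrier R" for g x
    using ideal_unit_central[OF id un] that by blast
  have bE: "\<beta> g x \<in> E g" if "g \<in> mor G" "x \<in> E (ginv G g)" for g x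
    using iso[OF that(1)] that(2) by (auto simp: algebra_iso_on_def bij_betw_def)
  have ba: "\<beta> g (x \<oplus>\<^bsub>R\<^esub> y) = \<beta> g x \<oplus>\<^bsub>R\<^esub> \<beta> g y"
    and bm: "\<beta> g (x \<otimes>\<^bsub>R\<^esub> y) = \<beta> g x \<otimes>\<^bsub>R\<^esub> \<beta> g y"
    if "g \<in> mor G" "x \<in> E (ginv G g)" "y \<in> E (ginv G g)" for g x y
    using iso[OF that(1)] that(2,3) by (auto simp: algebra_iso_on_def)
  have xu: "x \<otimes>\<^bsub>R\<^esub> ?u (ginv G g) \<in> E (ginv G g)" if "g \<in> mor G" "x \<in> carrier R" for g x
    using that by (intro EL uE ginv_closed)
  have fo: "finite (objs G (mor G))" using assms(2) by (simp add: objs_def)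
  have om: "e \<in> mor G" if "e \<in> objs G (mor G)" for e using that by (simp add: objs_def)
  \<comment> \<open>The product lies in both ideals, and distinct summands meet only in
    zero.\<close>
  have orth: "?u e \<otimes>\<^bsub>R\<^esub> a = \<zero>\<^bsub>R\<^esub>"
    if "e \<in> objs G (mor G)" "f \<in> objs G (mor G)" "e \<noteq> f" "a \<in> E f" for e f a
  proof (rule internal_direct_sum_Int[OF dsum fo _ that(1-3)])
    show "?u e \<otimes>\<^bsub>R\<^esub> a \<in> E e"
      by (rule ER[OF om uE[OF om] Ec[OF om]]) (fact that)+
    show "?u e \<otimes>\<^bsub>R\<^esub> a \<in> E f"
      by (rule EL[OF om _ uc[OF om]]) (fact that)+
  qed (rule E0[OF om])
  \<comment> \<open>Decompose one along the direct sum as a family a. Multiplying by the unit at f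
    annihilates every entry but \<open>a f\<close>, so the entries are the units.\<close>
  have "(\<Oplus>\<^bsub>R\<^esub>e\<in>objs G (mor G). ?u e) = \<one>\<^bsub>R\<^esub>"
  proof -
    obtain a where a: "a \<in> (\<Pi>\<^sub>E e\<in>objs G (mor G). E e)"
        and one: "\<one>\<^bsub>R\<^esub> = (\<Oplus>\<^bsub>R\<^esub>e\<in>objs G (mor G). a e)"
      using dsum one_closed unfolding internal_direct_sum_def by blast
    have aE: "a e \<in> E e" if "e \<in> objs G (mor G)" for e using a that by auto
    have aR: "a e \<in> carrier R" if "e \<in> objs G (mor G)" for e
      using aE om Ec that by blast
    have "?u f = a f" if f: "f \<in> objs G (mor G)" for f
    proof -
      have "?u f = ?u f \<otimes>\<^bsub>R\<^esub> \<one>\<^bsub>R\<^esub>" using f om uc by simp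
      also have "\<dots> = (\<Oplus>\<^bsub>R\<^esub>e\<in>objs G (mor G). ?u f \<otimes>\<^bsub>R\<^esub> a e)"
        unfolding one using f om uc aR fo by (intro finsum_rdistr) auto
      also have "\<dots> = (\<Oplus>\<^bsub>R\<^esub>e\<in>objs G (mor G). if f = e then a e else \<zero>\<^bsub>R\<^esub>)"
        using f aR aE om ul orth by (intro finsum_cong') auto
      also have "\<dots> = a f"
        using f fo aR by (intro finsum_singleton) auto
      finally show ?thesis .
    qed
    then show ?thesis
      unfolding one using aR by (intro finsum_cong') auto
  qed
  then show ?thesis
  \<comment> \<open>The sum of the units is chained in as first premise of every case, so the
    hypotheses proper start at index 2; case 6 is the chained fact itself.\<close>
  proof (unfold_locales, goal_cases)
    case 1 then show ?case by (simp add: assms(2))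
  next
    case 2 then show ?case by (intro uc)
  next
    case 3 then show ?case by (intro cen)
  next
    case (4 g) then show ?case using Er[of g] by simp
  next
    case (5 e f) then show ?case using orth[OF 5(2-4) uE[OF om[OF 5(3)]]] by simp
  next
    case 6 then show ?case by simp
  next
    case (7 g x)
    then show ?case by (intro Ec[OF _ bE[OF _ xu]])
  next
    case (8 g x y)
    then show ?case
      using ba[OF 8(2) xu[OF 8(2,3)] xu[OF 8(2,4)]] by (simp add: l_distr uc ginv_closed)
  next
    case (9 g x y)
    have v: "?u (ginv G g) \<in> carrier R" using 9 by (simp add: uc ginv_closed)
    have "x \<otimes>\<^bsub>R\<^esub> ?u (ginv G g) \<otimes>\<^bsub>R\<^esub> (y \<otimes>\<^bsub>R\<^esub> ?u (ginv G g))
        = x \<otimes>\<^bsub>R\<^esub> (?u (ginv G g) \<otimes>\<^bsub>R\<^esub> (y \<otimes>\<^bsub>R\<^esub> ?u (ginv G g)))"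
      using 9(3,4) v by (simp add: m_assoc)
    also have "\<dots> = x \<otimes>\<^bsub>R\<^esub> y \<otimes>\<^bsub>R\<^esub> ?u (ginv G g)"
      using 9(3,4) v ul[OF ginv_closed[OF 9(2)] xu[OF 9(2,4)]] by (simp add: m_assoc)
    finally show ?case
      using bm[OF 9(2) xu[OF 9(2,3)] xu[OF 9(2,4)]] by simp
  next
    case (10 g x)
    then show ?case by (intro ur bE xu)
  next
    case (11 g x)
    then show ?case
      using ur[OF ginv_closed[OF 11(2)] xu[OF 11(2,3)]] Ei[OF 11(2)] by simp
  next
    case (12 g h x)
    have x: "x \<otimes>\<^bsub>R\<^esub> ?u (ginv G h) \<in> E (ginv G h)"
      using 12 by (intro xu)
    \<comment> \<open>Composability puts the values of \<open>\<beta> h\<close> into the domain of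
      \<open>\<beta> g\<close>, so cutting them again changes nothing; the composite has the same
      domain as \<open>\<beta> h\<close>.\<close>
    have "E (ginv G g) = E h"
      using Ei[OF 12(2)] Er[OF 12(3)] 12(4) by simp
    then have "\<beta> h (x \<otimes>\<^bsub>R\<^esub> ?u (ginv G h)) \<otimes>\<^bsub>R\<^esub> ?u (ginv G g) = \<beta> h (x \<otimes>\<^bsub>R\<^esub> ?u (ginv G h))"
      using ur[OF 12(3) bE[OF 12(3) x]] by simp
    moreover have "E (ginv G (cmp G g h)) = E (ginv G h)"
      using Ei[OF 12(3)] Ei[OF cmp_closed[OF 12(2-4)]] dmn_cmp[OF 12(2-4)] by simp
    ultimately show ?case using b2[OF 12(2-4) x] by simp
  qed
qed

section \<open>Injectivity of the Galois map on wide subgroupoids\<close>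

theorem theorem4p3:
  fixes G :: "'g category_data"
    and K :: "('k, 'n) ring_scheme"
    and R :: "('k, 'a, 'm) module_scheme"
    and E :: "'g \<Rightarrow> 'a set"
    and \<beta> :: "'g \<Rightarrow> 'a \<Rightarrow> 'a"
  assumes "groupoid G" and "finite (mor G)"
    and "cring K" and "assoc_algebra K R"
    and "unital_groupoid_action G K R E \<beta>"
    and "internal_direct_sum R (objs G (mor G)) E"
    and "galois_extension G R E \<beta>"
    and "separable_over (R\<lparr>carrier := invariant_ring G R E \<beta> (mor G)\<rparr>)
           (ring_center R \<inter> invariant_ring G R E \<beta> (mor G))"
    and "\<And>H. wide_subgroupoid G H \<Longrightarrow> S_class G R E \<beta> H = {H}"
  shows "inj_on (galois_map G R E \<beta>) {H. wide_subgroupoid G H}"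
proof -
  have ringR: "ring R" using assms(4) by (simp add: assoc_algebra_def)
  define u where "u = (\<lambda>g. ideal_unit R (E g))"
  define b where "b = (\<lambda>g x. \<beta> g (x \<otimes>\<^bsub>R\<^esub> ideal_unit R (E (ginv G g))))"
  interpret total_groupoid_action G R u b
    unfolding u_def b_def
    using total_groupoid_action_of_unital[OF assms(1,2) ringR assms(5,6)] .
  obtain m x y where xy: "\<And>i. i \<in> {1..m::nat} \<Longrightarrow> x i \<in> carrier R \<and> y i \<in> carrier R"
    and gal: "\<And>g. g \<in> mor G \<Longrightarrow> (\<Oplus>\<^bsub>R\<^esub>i\<in>{1..m}. x i \<otimes>\<^bsub>R\<^esub> b g (y i)) =
      (\<Oplus>\<^bsub>R\<^esub>e\<in>objs G (mor G). if e = g then u e else \<zero>\<^bsub>R\<^esub>)"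
    using assms(7) unfolding galois_extension_def b_def u_def by blast
  have fo: "finite (objs G (mor G))" using assms(2) by (simp add: objs_def)
  have uo: "u \<in> objs G (mor G) \<rightarrow> carrier R" by (auto simp: objs_def u_closed)
  interpret galois_groupoid_action G R u b "{1..m}" x y
  proof
    fix g assume g: "g \<in> mor G"
    \<comment> \<open>Only the term at e = g can survive, and it occurs only if g is an
      object.\<close>
    have "(\<Oplus>\<^bsub>R\<^esub>e\<in>objs G (mor G). if e = g then u e else \<zero>\<^bsub>R\<^esub>)
        = (if g \<in> objs G (mor G) then u g else \<zero>\<^bsub>R\<^esub>)"
    proof (cases "g \<in> objs G (mor G)")
      case True
      then show ?thesis using add.finprod_singleton_swap[OF True fo uo] by simp
    next
      case False
      then show ?thesis by (simp, intro add.finprod_one_eqI) auto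
    qed
    then show "(\<Oplus>\<^bsub>R\<^esub>i\<in>{1..m}. x i \<otimes>\<^bsub>R\<^esub> b g (y i)) = (if g \<in> objs G (mor G) then u g else \<zero>\<^bsub>R\<^esub>)"
      using gal[OF g] by simp
  qed (use xy in auto)
  have inv: "galois_map G R E \<beta> H = invariants H" for H
    unfolding galois_map_def invariant_ring_def invariants_def unfolding b_def u_def ..
  \<comment> \<open>Membership in E_g means being fixed by right multiplication by its unit: one
    direction is the unit law, the other the ideal property.\<close>
  have J: "J_set G R E \<beta> g = twisted_center g" if g: "g \<in> mor G" for g
  proof -
    have id: "ideal (E g) R" and "\<exists>v. is_ideal_unit R (E g) v"
      using assms(5) g unfolding unital_groupoid_action_def groupoid_action_def by blast+
    then have "is_ideal_unit R (E g) (u g)"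
      unfolding u_def using is_ideal_unit_ideal_unit by blast
    then have "r \<in> E g \<longleftrightarrow> r \<in> carrier R \<and> r \<otimes>\<^bsub>R\<^esub> u g = r" for r
      using ideal.Icarr[OF id] ideal.I_l_closed[OF id, of "u g" r]
      by (auto simp: is_ideal_unit_def)
    then show ?thesis
      unfolding J_set_def twisted_center_def unfolding b_def by blast
  qed
  \<comment> \<open>The hypotheses are symmetric in \<open>H\<close> and \<open>L\<close>, so an
    exchange gives the reverse inclusion.\<close>
  have sub: "S_set G R E \<beta> H \<subseteq> S_set G R E \<beta> L"
    if "wide_subgroupoid G H" "wide_subgroupoid G L" "invariants H = invariants L" for H L
  proof
    fix h assume "h \<in> S_set G R E \<beta> H"
    then have h: "h \<in> H" "J_set G R E \<beta> h \<noteq> {\<zero>\<^bsub>R\<^esub>}" by (auto simp: S_set_def)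
    moreover have "h \<in> mor G"
      using h(1) that(1) by (auto simp: wide_subgroupoid_def subgroupoid_def)
    ultimately show "h \<in> S_set G R E \<beta> L"
      using twisted_center_nonzero_subset[OF that h(1)] by (simp add: S_set_def J)
  qed
  show ?thesis
  proof (rule inj_onI, unfold mem_Collect_eq)
    fix H L
    assume HL: "wide_subgroupoid G H" "wide_subgroupoid G L"
      "galois_map G R E \<beta> H = galois_map G R E \<beta> L"
    then have "S_set G R E \<beta> L = S_set G R E \<beta> H"
      using sub[of H L] sub[of L H] by (simp add: inv)
    \<comment> \<open>By hypothesis this class is the singleton of \<open>H\<close>.\<close>
    then have "L \<in> S_class G R E \<beta> H"
      using HL(2) by (simp add: S_class_def wide_subgroupoid_def)
    then show "H = L" using assms(9)[OF HL(1)] by simp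
  qed
qed

end
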